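(* Let $W\subset S^1$ with $|W|=4$ satisfy condition $T''(W)$: $(W+\tfrac i5)\cap W=\emptyset$ for $i=1,2,3,4$ (equivalently, the four elements of $W$ lie in distinct orbits of the rotation $x\mapsto x+\tfrac15$). Then either $P(W)$ holds, or $W\cong\{0,\tfrac14,\tfrac12,\tfrac34\}$.
   Context: Identify $S^1$ with $\mathbb{R}/\mathbb{Z}$. The group $O(2)$ acts on $S^1$ by translations $x\mapsto x+a$ and reflections $x\mapsto -x+2a$. A coloring $c:S^1\to\{R,B\}$ is distinguishing if no non-identity $\gamma\in O(2)$ satisfies $c\circ\gamma=c$. For $W\subset S^1$ with trivial pointwise stabilizer in $O(2)$, $P(W)$ holds if every precoloring $c:S^1\setminus W\to\{R,B\}$ extends to a distinguishing coloring of $S^1$. Write $W\cong W'$ if $W'=\gamma(W)$ for some $\gamma\in O(2)$. *)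

theory Defs
  imports Complex_Main
begin

text \<open>The circle S^1 = R/Z is represented by its canonical set of
representatives [0,1) of reals; arithmetic is taken modulo 1 via frac.\<close>

definition S1 :: "real set" where
  "S1 = {0..<1}"

datatype O2 = Rot real | Refl real

fun act :: "O2 \<Rightarrow> real \<Rightarrow> real" where
  "act (Rot a) x = frac (x + a)"
| "act (Refl a) x = frac (- x + 2 * a)"

definition is_identity :: "O2 \<Rightarrow> bool" where
  "is_identity g \<longleftrightarrow> (\<forall>x\<in>S1. act g x = x)"

text \<open>Colorings S^1 -> {R,B}, with R = True, B = False; only values on S1 matter.\<close>
definition distinguishing :: "(real \<Rightarrow> bool) \<Rightarrow> bool" where
  "distinguishing c \<longleftrightarrow>
     (\<forall>g. (\<forall>x\<in>S1. c (act g x) = c x) \<longrightarrow> is_identity g)"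

definition trivial_pointwise_stabilizer :: "real set \<Rightarrow> bool" where
  "trivial_pointwise_stabilizer W \<longleftrightarrow>
     (\<forall>g. (\<forall>x\<in>W. act g x = x) \<longrightarrow> is_identity g)"

definition P :: "real set \<Rightarrow> bool" where
  "P W \<longleftrightarrow> (\<forall>c :: real \<Rightarrow> bool. \<exists>d. distinguishing d \<and> (\<forall>x\<in>S1 - W. d x = c x))"

definition congruent_sets :: "real set \<Rightarrow> real set \<Rightarrow> bool" where
  "congruent_sets W W' \<longleftrightarrow> (\<exists>g. W' = act g ` W)"

definition T2 :: "real set \<Rightarrow> bool" where
  "T2 W \<longleftrightarrow> (\<forall>i::nat\<in>{1..4}. (\<lambda>x. frac (x + real i / 5)) ` W \<inter> W = {})"

end

theory Submission
  imports Defs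
begin

text \<open>
  It suffices to find a scalene triple \<open>X \<subseteq> W\<close>: four points all of whose triples are isosceles form
  a square or four vertices of a regular pentagon. For a scalene triple already one of the eight
  recolorings of \<open>X\<close> is distinguishing. Suppose all eight are symmetric.

  If one of them, \<open>d\<close>, is invariant under a nontrivial rotation, then the recolorings at a single
  point force \<open>d\<close> to be invariant under the reflection at each point of \<open>X\<close>, hence under
  the rotations by \<open>2(x - y)\<close>; as the circle has only one involution, \<open>X\<close> meets at most two
  orbits of the rotation group of \<open>d\<close>, on each of which \<open>d\<close> is constant, so that symmetries of recolorings become symmetries of subsets of \<open>X\<close>.

  Otherwise each recoloring has a unique reflection. Take \<open>d\<close> constant on \<open>X\<close>, with reflection
  \<open>u \<mapsto> k - u\<close>. Composing with the reflection of the recoloring at \<open>x\<close> gives a rotation under which \<open>d\<close>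
  changes at exactly two points. Comparing these rotations for the points of \<open>X\<close> shows that, up
  to one point \<open>e\<close> on the axis, \<open>d\<close> is invariant under the rotations by \<open>e - x\<close>; then all
  subsets of \<open>{e} \<union> X\<close> containing \<open>e\<close> are symmetric, and so is \<open>X\<close>. The exception is an axis through
  two points of \<open>X\<close>; it cannot be the axis both for \<open>d\<close> and for its complement on \<open>X\<close>.
\<close>

section \<open>Symmetric colorings of a group with one involution\<close>

text \<open>Abstracts the feature of R/Z on which the coloring arguments rest: at most one element
  has order two. Working in a group also avoids reductions modulo 1.\<close>

class circle_group = ab_group_add +
  assumes unique_involution:
    "s + s = 0 \<Longrightarrow> t + t = 0 \<Longrightarrow> s \<noteq> 0 \<Longrightarrow> t \<noteq> 0 \<Longrightarrow> s = t"

definition rot_inv :: "('a::ab_group_add \<Rightarrow> bool) \<Rightarrow> 'a \<Rightarrow> bool" where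
  "rot_inv d t \<longleftrightarrow> (\<forall>u. d (u + t) = d u)"

definition refl_inv :: "('a::ab_group_add \<Rightarrow> bool) \<Rightarrow> 'a \<Rightarrow> bool" where
  "refl_inv d k \<longleftrightarrow> (\<forall>u. d (k - u) = d u)"

definition motion :: "('a::ab_group_add \<Rightarrow> 'a) \<Rightarrow> bool" where
  "motion g \<longleftrightarrow> (\<exists>t. t \<noteq> 0 \<and> g = (\<lambda>u. u + t)) \<or> (\<exists>k. g = (\<lambda>u. k - u))"

definition symmetric :: "('a::ab_group_add \<Rightarrow> bool) \<Rightarrow> bool" where
  "symmetric d \<longleftrightarrow> (\<exists>g. motion g \<and> (\<forall>u. d (g u) = d u))"

text \<open>Recolorings of \<open>X\<close> are encoded as flips of its subsets, so that performing
  two of them amounts to one flip of a symmetric difference.\<close>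

definition toggle :: "('a \<Rightarrow> bool) \<Rightarrow> 'a set \<Rightarrow> 'a \<Rightarrow> bool" where
  "toggle d X u \<longleftrightarrow> d u \<noteq> (u \<in> X)"

lemma symmetric_iff:
  "symmetric d \<longleftrightarrow> (\<exists>t. t \<noteq> 0 \<and> rot_inv d t) \<or> (\<exists>k. refl_inv d k)"
  unfolding symmetric_def motion_def rot_inv_def refl_inv_def by blast

lemma toggle_toggle: "toggle (toggle d X) Y = toggle d ((X - Y) \<union> (Y - X))"
  by (auto simp: toggle_def fun_eq_iff)

lemma toggle_empty [simp]: "toggle d {} = d"
  by (auto simp: toggle_def fun_eq_iff)

lemma rot_inv_0 [simp]: "rot_inv d 0"
  by (simp add: rot_inv_def)

lemma rot_inv_add: "rot_inv d s \<Longrightarrow> rot_inv d t \<Longrightarrow> rot_inv d (s + t)"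
  by (simp add: rot_inv_def flip: add.assoc)

lemma rot_inv_minus: "rot_inv d t \<Longrightarrow> rot_inv d (- t)"
  unfolding rot_inv_def by (metis add_diff_cancel diff_conv_add_uminus)

lemma rot_inv_minus_iff: "rot_inv d (- t) \<longleftrightarrow> rot_inv d t"
  using rot_inv_minus by fastforce

lemma rot_inv_diff: "rot_inv d s \<Longrightarrow> rot_inv d t \<Longrightarrow> rot_inv d (s - t)"
  using rot_inv_add [OF _ rot_inv_minus] by fastforce

lemma rot_inv_of_refl_inv:
  assumes "refl_inv d k" "refl_inv d l"
  shows "rot_inv d (k - l)"
  unfolding rot_inv_def
proof
  fix u
  have "d (u + (k - l)) = d (k - (u + (k - l)))"
    using assms(1) unfolding refl_inv_def by metis
  also have "k - (u + (k - l)) = l - u" by simp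
  finally show "d (u + (k - l)) = d u"
    using assms(2) by (simp add: refl_inv_def)
qed

lemma motion_cases:
  assumes "motion g"
  obtains "\<And>u v. g u - g v = u - v" | "\<And>u v. g u - g v = v - u"
proof -
  have "(\<forall>u v. g u - g v = u - v) \<or> (\<forall>u v. g u - g v = v - u)"
    using assms unfolding motion_def by auto
  then show ?thesis using that by blast
qed

lemma motion_inj: "motion g \<Longrightarrow> g u = g v \<Longrightarrow> u = v"
  unfolding motion_def by auto

lemma motion_surj:
  assumes "motion g"
  obtains u where "g u = v"
proof -
  have "\<exists>u. g u = v"
    using assms unfolding motion_def by (metis diff_add_cancel diff_diff_eq2 add_diff_cancel_left')
  then show ?thesis using that by blast
qed

lemma motion_fixed:
  assumes "motion g" "g x = x"
  shows "g = (\<lambda>u. x + x - u)"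
  using assms unfolding motion_def by (auto simp: algebra_simps)

text \<open>A motion preserves differences up to sign, and the rotations preserving \<open>d\<close>
  are closed under negation. Hence motions permute the orbits.\<close>

lemma motion_rot_inv_iff:
  assumes "motion g"
  shows "rot_inv d (g u - g v) \<longleftrightarrow> rot_inv d (u - v)"
  using assms rot_inv_minus_iff [of d "u - v"] by (cases rule: motion_cases) auto

text \<open>Orbits under the rotations that preserve the coloring, not under all rotations.\<close>

definition orbit :: "('a::ab_group_add \<Rightarrow> bool) \<Rightarrow> 'a \<Rightarrow> 'a set" where
  "orbit d u = {v. rot_inv d (v - u)}"

lemma orbit_eq_iff: "orbit d u = orbit d v \<longleftrightarrow> rot_inv d (u - v)"
proof
  assume "orbit d u = orbit d v"
  moreover have "u \<in> orbit d u" by (simp add: orbit_def)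
  ultimately show "rot_inv d (u - v)" by (simp add: orbit_def)
next
  assume uv: "rot_inv d (u - v)"
  have "rot_inv d (w - u) \<longleftrightarrow> rot_inv d (w - v)" for w
    using rot_inv_add [OF _ uv, of "w - u"] rot_inv_diff [OF _ uv, of "w - v"] by auto
  then show "orbit d u = orbit d v" by (simp add: orbit_def)
qed

lemma orbit_add: "rot_inv d r \<Longrightarrow> orbit d (u + r) = orbit d u"
  by (simp add: orbit_eq_iff)

lemma motion_orbit_iff:
  assumes "motion g"
  shows "orbit d (g u) = orbit d (g v) \<longleftrightarrow> orbit d u = orbit d v"
  using motion_rot_inv_iff [OF assms] by (simp add: orbit_eq_iff)

lemma orbit_color: "orbit d u = orbit d v \<Longrightarrow> d u = d v"
  unfolding orbit_eq_iff rot_inv_def by (metis add_diff_cancel_left' diff_add_cancel add.commute)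

text \<open>If the symmetry of the recoloring keeps the orbit, \<open>f\<close> is constant along it
  there, so \<open>Y\<close> itself must be preserved. If it moves the orbit away, all points of the
  orbit behave alike; then \<open>Y\<close> is the full orbit and is invariant under
  \<open>r\<close>.\<close>

lemma symmetric_subset_of_orbit:
  assumes r: "rot_inv f r" "r \<noteq> 0"
    and Y: "\<And>u. u \<in> Y \<Longrightarrow> orbit f u = orbit f p" "Y \<noteq> {}"
    and sym: "symmetric (toggle f Y)"
  shows "symmetric (\<lambda>u. u \<in> Y)"
proof -
  obtain g where g: "motion g" and inv: "\<And>u. toggle f Y (g u) = toggle f Y u"
    using sym unfolding symmetric_def by blast
  note orb = motion_orbit_iff [OF g, of f]
  show ?thesis
  proof (cases "orbit f (g p) = orbit f p")
    case True
    have coset: "orbit f (g u) = orbit f p \<longleftrightarrow> orbit f u = orbit f p" for u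
      using orb [of u p] True by simp
    have "g u \<in> Y \<longleftrightarrow> u \<in> Y" for u
    proof (cases "orbit f u = orbit f p")
      case True
      then have "f (g u) = f u"
        using coset [of u] by (intro orbit_color) simp
      then show ?thesis using inv [of u] by (auto simp: toggle_def)
    next
      case False
      then show ?thesis using coset [of u] Y(1) by blast
    qed
    then show ?thesis using g unfolding symmetric_def by blast
  next
    case False
    have const: "u \<in> Y \<longleftrightarrow> f (g p) \<noteq> f p" if u: "orbit f u = orbit f p" for u
    proof -
      have gu: "orbit f (g u) = orbit f (g p)" using u orb by simp
      then have "g u \<notin> Y" using False Y(1) by metis
      moreover have "f (g u) = f (g p)" "f u = f p"
        using orbit_color [OF u] orbit_color [OF gu] by simp_all
      ultimately show ?thesis using inv [of u] by (auto simp: toggle_def)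
    qed
    then have full: "u \<in> Y \<longleftrightarrow> orbit f u = orbit f p" for u
      using Y by blast
    have "u + r \<in> Y \<longleftrightarrow> u \<in> Y" for u
      unfolding full by (simp add: orbit_add r)
    then show ?thesis
      using r(2) unfolding symmetric_iff rot_inv_def by blast
  qed
qed

text \<open>A symmetry moving \<open>x\<close> would change the color \<open>d\<close> at
  \<open>x\<close>, hence also at \<open>x + r\<close>, which is not flipped; so
  \<open>x + r\<close> would go to \<open>x\<close>, which has the wrong color. A motion fixing
  \<open>x\<close> is the reflection at \<open>x\<close>, and this does not notice the flip.\<close>

lemma refl_inv_at_toggled_point:
  assumes r: "rot_inv d r" "r \<noteq> 0"
    and sym: "symmetric (toggle d {x})"
  shows "refl_inv d (x + x)"
proof -
  obtain g where g: "motion g" and inv: "\<And>u. toggle d {x} (g u) = toggle d {x} u"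
    using sym unfolding symmetric_def by blast
  have "g x = x"
  proof (rule ccontr)
    assume neq: "g x \<noteq> x"
    then have 1: "d (g x) \<noteq> d x" using inv [of x] by (auto simp: toggle_def)
    have 2: "d (g (x + r)) = d (g x)" "d (x + r) = d x"
      using r by (intro orbit_color; simp add: motion_orbit_iff [OF g] orbit_add)+
    then have "g (x + r) = x"
      using 1 r(2) inv [of "x + r"] by (auto simp: toggle_def)
    then have "d x = d (g x)" using 2 by simp
    then show False using 1 by simp
  qed
  then have g: "g = (\<lambda>u. x + x - u)" using motion_fixed g by blast
  show ?thesis unfolding refl_inv_def
  proof
    fix u
    show "d (x + x - u) = d u"
      using inv [of u] unfolding g by (auto simp: toggle_def algebra_simps)
  qed
qed

text \<open>Halving has at most two solutions, since two solutions differ by an involution.\<close>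

lemma involution_diff:
  fixes x y :: "'a::circle_group"
  assumes "x + x = k" "y + y = k" "z + z = k" "x \<noteq> z" "y \<noteq> z"
  shows "x = y"
proof -
  have "(x - z) + (x - z) = 0" "(y - z) + (y - z) = 0"
    using assms(1-3) by (simp_all add: algebra_simps)
  then have "x - z = y - z"
    using unique_involution assms(4,5) by (metis eq_iff_diff_eq_0)
  then show ?thesis by simp
qed

section \<open>Recolorings with a rotational symmetry\<close>

lemma toggle_change:
  assumes "\<And>u. toggle d X (g u) = toggle d X u"
  shows "d (g u) \<noteq> d u \<longleftrightarrow> (u \<in> X) \<noteq> (g u \<in> X)"
  using assms [of u] by (auto simp: toggle_def)

text \<open>Whether a motion changes the color is decided orbit by orbit, so a change forced at a
  flipped point spreads to unflipped points of its orbit.\<close>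

lemma change_orbit:
  assumes "motion g" "orbit d u = orbit d v"
  shows "(d (g u) \<noteq> d u) = (d (g v) \<noteq> d v)"
  using assms motion_orbit_iff orbit_color by metis

text \<open>Modulo the rotations preserving \<open>d\<close>, the difference of \<open>x\<close> and
  \<open>y\<close> is its own negative, so translations act on these two orbits as reflections
  do.\<close>

lemma motion_swaps_orbits:
  assumes "motion g" "rot_inv d (x + x - (y + y))" "orbit d (g x) = orbit d y"
  shows "orbit d (g y) = orbit d x"
  using assms(1)
proof (cases rule: motion_cases)
  case 1
  have "g y - x = (g x - y) - (x + x - (y + y))"
    using 1 [of y x] by (simp add: algebra_simps)
  then show ?thesis using assms rot_inv_diff unfolding orbit_eq_iff by metis
next
  case 2
  have "g y - x = g x - y"
    using 2 [of y x] by (simp add: algebra_simps)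
  then show ?thesis using assms unfolding orbit_eq_iff by metis
qed

lemma motion_keeps_orbits:
  assumes "motion g" "rot_inv d (x + x - (y + y))" "orbit d (g x) = orbit d x"
  shows "orbit d (g y) = orbit d y"
  using assms(1)
proof (cases rule: motion_cases)
  case 1
  have "g y - y = g x - x"
    using 1 [of y x] by (simp add: algebra_simps)
  then show ?thesis using assms unfolding orbit_eq_iff by metis
next
  case 2
  have "g y - y = (g x - x) + (x + x - (y + y))"
    using 2 [of y x] by (simp add: algebra_simps)
  then show ?thesis using assms rot_inv_add unfolding orbit_eq_iff by metis
qed

text \<open>If the symmetry keeps the orbit of \<open>x\<close>, it fixes both \<open>x\<close> and
  \<open>y\<close>. If it sends this orbit to that of \<open>y\<close>, the unflipped points
  \<open>z\<close> and \<open>w\<close> change color too and would both have to land on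
  \<open>y\<close>. Elsewhere, \<open>x\<close> must change color and \<open>z\<close> must
  not.\<close>

lemma toggled_pair_antipodal:
  assumes sq: "rot_inv d (x + x - (y + y))"
    and orb: "orbit d z = orbit d x" "orbit d w = orbit d x" "orbit d y \<noteq> orbit d x"
    and dist: "distinct [x, z, w]"
    and colors: "d x \<noteq> d y"
    and sym: "symmetric (toggle d {x, y})"
  shows "x + x = y + y"
proof -
  obtain g where g: "motion g" and inv: "\<And>u. toggle d {x, y} (g u) = toggle d {x, y} u"
    using sym unfolding symmetric_def by blast
  note E = toggle_change [of d "{x, y}" g, OF inv]
  have gz: "orbit d (g z) = orbit d (g x)" "orbit d (g w) = orbit d (g x)"
    using motion_orbit_iff [OF g] orb by auto
  have zy: "z \<noteq> y" "w \<noteq> y" using orb by auto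
  consider "orbit d (g x) = orbit d x" | "orbit d (g x) = orbit d y"
    | "orbit d (g x) \<noteq> orbit d x" "orbit d (g x) \<noteq> orbit d y" by blast
  then show ?thesis
  proof cases
    case 1
    then have 2: "orbit d (g y) = orbit d y" using motion_keeps_orbits [OF g sq] by blast
    have "d (g x) = d x" "d (g y) = d y" using orbit_color [OF 1] orbit_color [OF 2] by simp_all
    then have "g x \<in> {x, y}" "g y \<in> {x, y}" using E [of x] E [of y] by auto
    then have "g x = x" "g y = y" using 1 2 orb(3) by auto
    then show ?thesis using motion_fixed [OF g, of x] by (metis diff_eq_eq)
  next
    case 2
    then have "d (g x) \<noteq> d x" using colors orbit_color by metis
    then have *: "d (g z) \<noteq> d z" "d (g w) \<noteq> d w"
      using change_orbit [OF g orb(1)] change_orbit [OF g orb(2)] by auto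
    have "g z \<in> {x, y}" "g w \<in> {x, y}"
      using * E [of z] E [of w] zy dist by auto
    moreover have "g z \<noteq> x" "g w \<noteq> x"
      using gz 2 orb(3) by auto
    ultimately have "g z = g w" by simp
    then show ?thesis using motion_inj [OF g] dist by auto
  next
    case 3
    have "g x \<notin> {x, y}" "g z \<notin> {x, y}"
      using 3 gz by (metis insert_iff empty_iff)+
    then have "d (g x) \<noteq> d x" "\<not> d (g z) \<noteq> d z"
      using E [of x] E [of z] zy dist by auto
    then show ?thesis using change_orbit [OF g orb(1)] by blast
  qed
qed

lemma symmetric_triple_two_orbits:
  fixes d :: "'a::circle_group \<Rightarrow> bool"
  assumes r: "rot_inv d r" "r \<noteq> 0"
    and sq: "rot_inv d (x + x - (y + y))" "rot_inv d (z + z - (y + y))"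
    and orb: "orbit d z = orbit d x" "orbit d y \<noteq> orbit d x" "z \<noteq> x"
    and sym: "symmetric (toggle d {x, y, z})" "symmetric (toggle d {x, y})"
      "symmetric (toggle d {z, y})"
  shows "symmetric (\<lambda>u. u \<in> {x, y, z})"
proof -
  obtain g where g: "motion g" and inv: "\<And>u. toggle d {x, y, z} (g u) = toggle d {x, y, z} u"
    using sym unfolding symmetric_def by blast
  note E = toggle_change [of d "{x, y, z}" g, OF inv]
  note gorb = motion_orbit_iff [OF g, of d]
  have gz: "orbit d (g z) = orbit d (g x)" using gorb orb by simp
  have zy: "z \<noteq> y" "x \<noteq> y" using orb by auto
  consider "orbit d (g x) = orbit d x" | "orbit d (g x) = orbit d y"
    | "orbit d (g x) \<noteq> orbit d x" "orbit d (g x) \<noteq> orbit d y" by blast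
  then show ?thesis
  proof cases
    case 1
    then have 2: "orbit d (g y) = orbit d y" using motion_keeps_orbits [OF g sq(1)] by blast
    have gx: "orbit d (g u) = orbit d x \<longleftrightarrow> orbit d u = orbit d x" for u
      using 1 gorb [of u x] by simp
    have gy: "orbit d (g u) = orbit d y \<longleftrightarrow> orbit d u = orbit d y" for u
      using 2 gorb [of u y] by simp
    have "g u \<in> {x, y, z} \<longleftrightarrow> u \<in> {x, y, z}" for u
    proof (cases "orbit d u = orbit d x \<or> orbit d u = orbit d y")
      case True
      then have "d (g u) = d u" using gx [of u] gy [of u] by (intro orbit_color) auto
      then show ?thesis using E [of u] by blast
    next
      case False
      moreover have "v \<notin> {x, y, z}" if "orbit d v \<noteq> orbit d x" "orbit d v \<noteq> orbit d y" for v
        using that orb by auto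
      ultimately show ?thesis using gx [of u] gy [of u] by metis
    qed
    then show ?thesis using g unfolding symmetric_def by blast
  next
    case 2
    have cx: "d (g u) \<noteq> d u \<longleftrightarrow> d x \<noteq> d y" if "orbit d u = orbit d x" for u
      using change_orbit [OF g that] orbit_color [OF 2] by auto
    have notin: "g x \<noteq> x" "g x \<noteq> z" "g z \<noteq> x" "g z \<noteq> z"
      using 2 gz orb by auto
    have colors: "d x \<noteq> d y"
    proof
      assume "d x = d y"
      then have "d (g x) = d x" "d (g z) = d z" using cx [of x] cx [of z] orb by auto
      then have "g x = y" "g z = y" using E [of x] E [of z] notin by auto
      then show False using motion_inj [OF g] orb(3) by metis
    qed
    \<comment> \<open>The preimage of \<open>y\<close> is a third point of the orbit of
      \<open>x\<close>, as needed to apply \<open>toggled_pair_antipodal\<close> to both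
      \<open>x\<close> and \<open>z\<close>. Three points with the same double are one too
      many.\<close>
    obtain w where w: "g w = y" using motion_surj [OF g] .
    have wx: "orbit d w = orbit d x"
      using gorb [of w x] w 2 by simp
    have "g x \<noteq> y" "g z \<noteq> y"
      using E [of x] E [of z] cx [of x] cx [of z] orb(1) colors by auto
    then have dist: "distinct [x, z, w]" "distinct [z, x, w]" using w orb(3) by auto
    have "x + x = y + y"
      using toggled_pair_antipodal [OF sq(1) orb(1) wx orb(2) dist(1) colors sym(2)] .
    moreover have "z + z = y + y"
      using toggled_pair_antipodal [OF sq(2) _ _ _ dist(2) _ sym(3)] orb wx colors
        orbit_color [OF orb(1)] by simp
    ultimately show ?thesis
      using involution_diff [of x "y + y" z y] orb zy by auto
  next
    case 3
    have "rot_inv d (y + y - (x + x))"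
      using rot_inv_minus [OF sq(1)] by simp
    then have 4: "orbit d (g y) \<noteq> orbit d x" "orbit d (g y) \<noteq> orbit d y"
      using 3 motion_swaps_orbits [OF g, of d y x] motion_keeps_orbits [OF g, of d y x] by blast+
    have yr: "orbit d (y + r) = orbit d y" using r by (simp add: orbit_add)
    have out: "v \<notin> {x, y, z}" if "orbit d v = orbit d (g y)" for v
      using that 4 orb(1) by auto
    \<comment> \<open>Both \<open>y\<close> and \<open>y + r\<close> are sent outside the triple,
      but only \<open>y\<close> is flipped, so only \<open>y\<close> may change color, although they
      share an orbit.\<close>
    have "g y \<notin> {x, y, z}" "g (y + r) \<notin> {x, y, z}"
      using out [of "g y"] out [of "g (y + r)"] gorb [of "y + r" y] yr by auto
    moreover have "y + r \<noteq> x" "y + r \<noteq> y" "y + r \<noteq> z"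
      using r(2) yr orb by auto
    ultimately have "d (g y) \<noteq> d y" "\<not> d (g (y + r)) \<noteq> d (y + r)"
      using E [of y] E [of "y + r"] by auto
    then show ?thesis using change_orbit [OF g yr] by blast
  qed
qed

lemma symmetric_triple_three_orbits:
  fixes d :: "'a::circle_group \<Rightarrow> bool"
  assumes r: "rot_inv d r" "r \<noteq> 0"
    and sq: "rot_inv d (x + x - (y + y))" "rot_inv d (x + x - (z + z))"
    and orb: "orbit d x \<noteq> orbit d y" "orbit d y \<noteq> orbit d z" "orbit d x \<noteq> orbit d z"
    and sym: "symmetric (toggle d {x, y, z})"
  shows "symmetric (\<lambda>u. u \<in> {x, y, z})"
proof (rule ccontr)
  assume neg: "\<not> ?thesis"
  obtain g where g: "motion g" and inv: "\<And>u. toggle d {x, y, z} (g u) = toggle d {x, y, z} u"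
    using sym unfolding symmetric_def by blast
  note E = toggle_change [of d "{x, y, z}" g, OF inv]
  obtain u where u: "(u \<in> {x, y, z}) \<noteq> (g u \<in> {x, y, z})"
    using neg g unfolding symmetric_def by blast
  have single: "v = w" if "v \<in> {x, y, z}" "w \<in> {x, y, z}" "orbit d v = orbit d w" for v w
    using that orb by auto
  \<comment> \<open>In the orbit of \<open>u\<close>, each point either is in the triple or is sent
    into it, but not both. Each orbit meets the triple at most once, so this orbit has at most two
    points, and \<open>u\<close>, \<open>u + s\<close>, \<open>u + (s + s)\<close> cannot be
    distinct.\<close>
  have order2: "s + s = 0" if s: "rot_inv d s" for s
  proof (rule ccontr)
    assume ss: "s + s \<noteq> 0"
    then have s0: "s \<noteq> 0" by auto
    have ch: "(v \<in> {x, y, z}) \<noteq> (g v \<in> {x, y, z})" if "orbit d v = orbit d u" for v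
      using change_orbit [OF g that] E [of v] E [of u] u by argo
    have c: "orbit d (u + s) = orbit d u" "orbit d (u + (s + s)) = orbit d u"
      using s rot_inv_add [OF s s] by (auto simp: orbit_add)
    have eq: "v = w"
      if "v \<in> {x, y, z} \<longleftrightarrow> w \<in> {x, y, z}" "orbit d v = orbit d u" "orbit d w = orbit d u" for v w
    proof (cases "v \<in> {x, y, z}")
      case True
      then show ?thesis using single [of v w] that by simp
    next
      case False
      then have "g v = g w"
        using single [of "g v" "g w"] ch [OF that(2)] ch [OF that(3)] that
          motion_orbit_iff [OF g, of d v w] by argo
      then show ?thesis using motion_inj [OF g] by blast
    qed
    have "u \<noteq> u + s" "u \<noteq> u + (s + s)" "u + s \<noteq> u + (s + s)"
      using ss s0 by simp_all
    then show False
      using eq [of "u + s" u] eq [of "u + (s + s)" u] eq [of "u + s" "u + (s + s)"] c by argo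
  qed
  have R: "s = 0 \<or> s = r" if "rot_inv d s" for s
    using that order2 r unique_involution by blast
  have eq: "orbit d v = orbit d w" if "v + v = w + w" for v w
  proof -
    have "(v - w) + (v - w) = 0" using that by (simp add: algebra_simps)
    then have "v - w = 0 \<or> v - w = r" using order2 [OF r(1)] r(2) unique_involution by blast
    then show ?thesis using r by (auto simp: orbit_eq_iff)
  qed
  \<comment> \<open>Both differences lie in {0, r}, and 0 is excluded because points with equal
    doubles share an orbit.\<close>
  have "x + x - (y + y) = r" "x + x - (z + z) = r"
    using R [OF sq(1)] R [OF sq(2)] eq orb by (metis eq_iff_diff_eq_0)+
  then have "y + y = z + z" by (metis diff_diff_eq2 add_diff_cancel_left' add.commute)
  then show False using eq orb by blast
qed

lemma symmetric_triple_if_rotation: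
  fixes d :: "'a::circle_group \<Rightarrow> bool"
  assumes r: "rot_inv d r" "r \<noteq> 0"
    and sym: "\<And>A. A \<subseteq> {x, y, z} \<Longrightarrow> symmetric (toggle d A)"
    and dist: "distinct [x, y, z]"
  shows "symmetric (\<lambda>u. u \<in> {x, y, z})"
proof -
  have refl: "refl_inv d (v + v)" if "v \<in> {x, y, z}" for v
    using refl_inv_at_toggled_point [OF r sym] that by auto
  have sq: "rot_inv d (v + v - (w + w))" if "v \<in> {x, y, z}" "w \<in> {x, y, z}" for v w
    using rot_inv_of_refl_inv [OF refl refl] that by blast
  have two: "symmetric (\<lambda>u. u \<in> {x, y, z})"
    if "orbit d b = orbit d a" "orbit d c \<noteq> orbit d a" "{x, y, z} = {a, c, b}" "b \<noteq> a" for a b c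
    using symmetric_triple_two_orbits [OF r sq sq that(1,2,4) sym sym sym]
    unfolding that(3) by simp
  consider "orbit d x = orbit d y" "orbit d x = orbit d z"
    | "orbit d x = orbit d y" "orbit d x \<noteq> orbit d z"
    | "orbit d x \<noteq> orbit d y" "orbit d x = orbit d z"
    | "orbit d y = orbit d z" "orbit d x \<noteq> orbit d y"
    | "orbit d x \<noteq> orbit d y" "orbit d x \<noteq> orbit d z" "orbit d y \<noteq> orbit d z"
    by blast
  then show ?thesis
  proof cases
    case 1
    show ?thesis
      by (rule symmetric_subset_of_orbit [OF r, of _ x]) (use 1 sym in auto)
  next
    case 2
    show ?thesis by (rule two [of y x z]) (use 2 dist in \<open>simp_all add: insert_commute eq_commute\<close>)
  next
    case 3
    show ?thesis by (rule two [of z x y]) (use 3 dist in \<open>simp_all add: insert_commute eq_commute\<close>)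
  next
    case 4
    show ?thesis by (rule two [of z y x]) (use 4 dist in \<open>simp_all add: insert_commute eq_commute\<close>)
  next
    case 5
    then show ?thesis
      using symmetric_triple_three_orbits [OF r sq sq _ _ _ sym, of x y z] by simp
  qed
qed

section \<open>Recolorings with reflections only\<close>

text \<open>The rotation composed of the two reflections changes \<open>d\<close> only at
  \<open>x\<close> and at its mirror image \<open>l - x\<close>; the two changes cancel if
  \<open>l\<close> fixes \<open>x\<close>.\<close>

lemma reflection_jump:
  assumes "refl_inv d k" "refl_inv (toggle d {x}) l"
  shows "d (u + (k - l)) \<longleftrightarrow> d u \<noteq> ((u = x) \<noteq> (u = l - x))"
proof -
  have "d (u + (k - l)) = d (k - (u + (k - l)))"
    using assms(1) unfolding refl_inv_def by metis
  also have "k - (u + (k - l)) = l - u" by simp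
  finally have "d (u + (k - l)) = d (l - u)" .
  moreover have "l - u = x \<longleftrightarrow> u = l - x" by (auto simp: algebra_simps)
  ultimately show ?thesis
    using assms(2) [unfolded refl_inv_def, rule_format, of u] by (auto simp: toggle_def)
qed

lemma refl_inv_toggle_fixed: "refl_inv (toggle d {w}) (w + w) \<longleftrightarrow> refl_inv d (w + w)"
proof -
  have "w + w - u = w \<longleftrightarrow> u = w" for u by (auto simp: algebra_simps)
  then show ?thesis by (auto simp: refl_inv_def toggle_def)
qed

text \<open>The rotations by \<open>a\<close> and \<open>b\<close> commute. Following the color of a
  point along both orders of the two rotations locates the points where it changes, and they meet in
  one point \<open>e\<close>.\<close>

lemma toggled_pair_center:
  assumes k: "refl_inv d k" and l: "refl_inv (toggle d {x}) l" and m: "refl_inv (toggle d {y}) m"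
    and xy: "x \<noteq> y" "d x = d y" "x + y \<noteq> k" and nfix: "l \<noteq> x + x" "m \<noteq> y + y"
    and e: "e = y + (k - m)"
  shows "e + e = k" "d e \<noteq> d x" "rot_inv (toggle d {e}) (e - x)" "rot_inv (toggle d {e}) (e - y)"
proof -
  define a b where "a = k - l" and "b = k - m"
  have Ja: "d (u + a) \<longleftrightarrow> d u \<noteq> ((u = x) \<noteq> (u = l - x))" for u
    using reflection_jump [OF k l] by (simp add: a_def)
  have Jb: "d (u + b) \<longleftrightarrow> d u \<noteq> ((u = y) \<noteq> (u = m - y))" for u
    using reflection_jump [OF k m] by (simp add: b_def)
  have "x \<noteq> l - x" "y \<noteq> m - y" using nfix by (auto simp: algebra_simps)
  then have xa: "d (x + a) \<noteq> d x" and yb: "d (y + b) \<noteq> d x" using Ja [of x] Jb [of y] xy by auto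
  have "k - (l - x) = x + a" "k - (m - y) = y + b" by (simp_all add: a_def b_def)
  then have lx: "d (l - x) \<noteq> d x" and my: "d (m - y) \<noteq> d x"
    using xa yb k unfolding refl_inv_def by metis+
  have ky: "d (k - y) = d x" using k xy unfolding refl_inv_def by metis
  have b0: "b \<noteq> 0" using yb xy by auto
  \<comment> \<open>The way from \<open>x\<close> over \<open>x + b\<close> to
    \<open>x + a + b\<close> never changes color, while the step from \<open>x\<close> to
    \<open>x + a\<close> does. So the step by \<open>b\<close> from \<open>x + a\<close> changes it
    back, which leaves only \<open>m - y\<close>.\<close>
  have "d (x + b) = d x" using Jb [of x] xy my by auto
  then have "d (x + b + a) = d x" using Ja [of "x + b"] b0 lx by auto
  then have "d (x + a + b) = d x" by (simp add: ac_simps)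
  then have P: "x + a = m - y" using Jb [of "x + a"] xa xy by auto
  \<comment> \<open>The same comparison one step earlier, starting from \<open>x - b\<close>: now
    the step by \<open>b\<close> into \<open>x + a\<close> must change the color, which leaves only
    \<open>y\<close> as its start.\<close>
  have Q: "x + a = y + b"
  proof -
    have "x - b \<noteq> y" using yb by auto
    moreover have "x - b \<noteq> m - y" using xy(3) by (auto simp: b_def algebra_simps)
    ultimately have xb: "d (x - b) = d x" using Jb [of "x - b"] by simp
    then have "d (x - b + a) = d x" using Ja [of "x - b"] b0 lx by auto
    moreover have "d (x + a) \<longleftrightarrow> d (x - b + a) \<noteq> ((x - b + a = y) \<noteq> (x - b + a = m - y))"
      using Jb [of "x - b + a"] by (simp add: algebra_simps)
    moreover have "x - b + a \<noteq> m - y"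
    proof
      assume "x - b + a = m - y"
      then have "x + a = k - y" by (simp add: b_def algebra_simps)
      then show False using xa ky by simp
    qed
    ultimately have "x - b + a = y" using xa by auto
    then show ?thesis by (auto simp: algebra_simps)
  qed
  have e': "e = x + a" "e = y + b" "e = m - y" using e P Q by (simp_all add: b_def)
  show ek: "e + e = k"
  proof -
    have "e + e = (y + b) + (m - y)" using e' by simp
    then show ?thesis by (simp add: b_def)
  qed
  have el: "e = l - x"
  proof -
    have "e = k - e" using ek by (simp add: algebra_simps)
    also have "\<dots> = l - x" unfolding e'(1) by (simp add: a_def)
    finally show ?thesis .
  qed
  show "d e \<noteq> d x" using xa e' by simp
  have ex: "e - x = a" "e - y = b" using e'(1,2) by (metis add_diff_cancel_left')+
  \<comment> \<open>The rotation by \<open>a\<close> changes the color at \<open>x\<close>, which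
    lands on \<open>e\<close>, and at \<open>e\<close>; flipping \<open>e\<close> absorbs both. The
    same holds for \<open>b\<close> and \<open>y\<close>.\<close>
  have "u + a = e \<longleftrightarrow> u = x" "u + b = e \<longleftrightarrow> u = y" for u using e'(1,2) by (metis add_right_cancel)+
  then show "rot_inv (toggle d {e}) (e - x)" "rot_inv (toggle d {e}) (e - y)"
    unfolding ex rot_inv_def toggle_def using Ja Jb el e'(3) by auto
qed

definition reflections_only :: "('a::ab_group_add \<Rightarrow> bool) \<Rightarrow> 'a set \<Rightarrow> bool" where
  "reflections_only d X \<longleftrightarrow>
    (\<forall>A\<subseteq>X. (\<exists>k. refl_inv (toggle d A) k) \<and> (\<forall>t. rot_inv (toggle d A) t \<longrightarrow> t = 0))"

lemma reflections_only_toggle: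
  assumes "reflections_only d X" "A \<subseteq> X"
  shows "reflections_only (toggle d A) X"
proof -
  have "(\<exists>k. refl_inv (toggle (toggle d A) B) k) \<and>
      (\<forall>t. rot_inv (toggle (toggle d A) B) t \<longrightarrow> t = 0)"
    if "B \<subseteq> X" for B
  proof -
    have "(A - B) \<union> (B - A) \<subseteq> X" using assms(2) that by blast
    then show ?thesis
      unfolding toggle_toggle using assms(1) [unfolded reflections_only_def] by metis
  qed
  then show ?thesis unfolding reflections_only_def by blast
qed

lemma reflections_only_unique:
  assumes "reflections_only d X" "refl_inv d k" "refl_inv d l"
  shows "k = l"
proof -
  have "rot_inv (toggle d {}) (k - l)" using rot_inv_of_refl_inv assms(2,3) by simp
  then have "k - l = 0" using assms(1) unfolding reflections_only_def by blast
  then show ?thesis by simp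
qed

text \<open>A reflection fixing \<open>w\<close> ignores the flip at \<open>w\<close>, so it would
  be a second reflection of \<open>d\<close>.\<close>

lemma reflections_only_point:
  assumes ro: "reflections_only d X" and k: "refl_inv d k" and w: "w \<in> X" "w + w \<noteq> k"
  obtains l where "refl_inv (toggle d {w}) l" "l \<noteq> w + w"
proof -
  obtain l where l: "refl_inv (toggle d {w}) l"
    using ro w(1) unfolding reflections_only_def by blast
  have "l \<noteq> w + w"
    using refl_inv_toggle_fixed [of d w] l reflections_only_unique [OF ro k] w(2) by auto
  then show ?thesis using l that by blast
qed

lemma symmetric_isosceles:
  assumes "x + x = y + z"
  shows "symmetric (\<lambda>u. u \<in> {x, y, z})"
proof -
  have "x + x - u = x \<longleftrightarrow> u = x" "x + x - u = y \<longleftrightarrow> u = z" "x + x - u = z \<longleftrightarrow> u = y" for u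
    using assms by (auto simp: algebra_simps)
  then have "refl_inv (\<lambda>u. u \<in> {x, y, z}) (x + x)" by (auto simp: refl_inv_def)
  then show ?thesis unfolding symmetric_iff by blast
qed

lemma symmetric_pullback:
  assumes "motion g" "symmetric d"
  shows "symmetric (\<lambda>u. d (g u))"
  using assms(1) unfolding motion_def
proof (elim disjE exE conjE)
  fix t assume g: "g = (\<lambda>u. u + t)"
  have "rot_inv (\<lambda>u. d (g u)) s" if "rot_inv d s" for s
    unfolding rot_inv_def g
    by (metis that add.assoc add.commute rot_inv_def)
  moreover have "refl_inv (\<lambda>u. d (g u)) (k - t - t)" if "refl_inv d k" for k
    unfolding refl_inv_def g
  proof
    fix u
    have "k - t - t - u + t = k - (u + t)" by (simp add: algebra_simps)
    then show "d (k - t - t - u + t) = d (u + t)" using that by (metis refl_inv_def)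
  qed
  ultimately show ?thesis using assms(2) unfolding symmetric_iff by blast
next
  fix l assume g: "g = (\<lambda>u. l - u)"
  have "rot_inv (\<lambda>u. d (g u)) s" if "rot_inv d s" for s
    unfolding rot_inv_def g
  proof
    fix u
    have "l - (u + s) + s = l - u" by (simp add: algebra_simps)
    then show "d (l - (u + s)) = d (l - u)" using that by (metis rot_inv_def)
  qed
  moreover have "refl_inv (\<lambda>u. d (g u)) (l + l - k)" if "refl_inv d k" for k
    unfolding refl_inv_def g
  proof
    fix u
    have "l - (l + l - k - u) = k - (l - u)" by (simp add: algebra_simps)
    then show "d (l - (l + l - k - u)) = d (l - u)" using that by (metis refl_inv_def)
  qed
  ultimately show ?thesis using assms(2) unfolding symmetric_iff by blast
qed

lemma no_axis_through_triple:
  assumes ro: "reflections_only d X" and X: "X = {x, y, z}"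
    and scalene: "\<not> symmetric (\<lambda>u. u \<in> X)" and dist: "distinct [x, y, z]"
    and k: "refl_inv d k" and colors: "d x = d z" "d y = d z"
    and nfix: "x + x \<noteq> k" "y + y \<noteq> k" "z + z \<noteq> k" and npair: "x + z \<noteq> k" "y + z \<noteq> k"
  shows False
proof -
  obtain lx ly lz where l: "refl_inv (toggle d {x}) lx" "lx \<noteq> x + x"
    "refl_inv (toggle d {y}) ly" "ly \<noteq> y + y" "refl_inv (toggle d {z}) lz" "lz \<noteq> z + z"
    using reflections_only_point [OF ro k] X nfix by (metis insertCI)
  \<comment> \<open>This center depends on \<open>z\<close> alone, so the pairs \<open>x\<close>,
    \<open>z\<close> and \<open>y\<close>, \<open>z\<close> share it.\<close>
  define e where "e = z + (k - lz)"
  note cx = toggled_pair_center [OF k l(1) l(5) _ colors(1) npair(1) l(2) l(6) e_def]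
  note cy = toggled_pair_center [OF k l(3) l(5) _ colors(2) npair(2) l(4) l(6) e_def]
  define f where "f = toggle d {e}"
  have de: "d e \<noteq> d x" using cx dist by simp
  then have enot: "e \<noteq> x" "e \<noteq> y" "e \<noteq> z" using colors by auto
  have rots: "rot_inv f (e - x)" "rot_inv f (e - y)" "rot_inv f (e - z)"
    unfolding f_def using cx cy dist by simp_all
  then have orb: "orbit f w = orbit f e" if "w \<in> {e, x, y, z}" for w
    using that orbit_eq_iff [of f e] by (metis insert_iff empty_iff)
  have sym: "symmetric (\<lambda>u. u \<in> insert e A)" if "A \<subseteq> X" for A
  proof (rule symmetric_subset_of_orbit [OF rots(1), of _ e])
    show "e - x \<noteq> 0" using enot by simp
    show "orbit f u = orbit f e" if "u \<in> insert e A" for u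
      using orb that \<open>A \<subseteq> X\<close> X by blast
    have "e \<notin> A" using enot that X by blast
    then have "toggle f (insert e A) = toggle d A"
      by (auto simp: f_def toggle_def fun_eq_iff)
    then show "symmetric (toggle f (insert e A))"
      using ro that unfolding reflections_only_def symmetric_iff by metis
  qed simp
  obtain g where g: "motion g" and inv: "\<And>u. g u \<in> insert e X \<longleftrightarrow> u \<in> insert e X"
    using sym [of X] unfolding symmetric_def by blast
  have "g e \<in> insert e X" using inv by blast
  moreover have "g e \<noteq> e"
  proof
    assume ge: "g e = e"
    have "g u \<in> X \<longleftrightarrow> u \<in> X" for u
      using inv [of u] enot X ge motion_inj [OF g, of u e] by auto
    then show False using scalene g unfolding symmetric_def by blast
  qed
  ultimately have geX: "g e \<in> X" by blast
  \<comment> \<open>Since \<open>g\<close> permutes \<open>insert e X\<close>, removing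
    \<open>g e\<close> from it and pulling back along \<open>g\<close> removes \<open>e\<close>,
    which leaves \<open>X\<close>.\<close>
  have "insert e (X - {g e}) = insert e X - {g e}" using \<open>g e \<noteq> e\<close> by blast
  then have "symmetric (\<lambda>u. u \<in> insert e X - {g e})" using sym [of "X - {g e}"] by auto
  then have "symmetric (\<lambda>u. g u \<in> insert e X - {g e})" by (rule symmetric_pullback [OF g])
  moreover have "g u \<in> insert e X - {g e} \<longleftrightarrow> u \<in> X" for u
    using inv [of u] motion_inj [OF g, of u e] enot X by auto
  ultimately show False using scalene by simp
qed

text \<open>Flipping \<open>x\<close> keeps the axis, so the pair \<open>y\<close>, \<open>z\<close>
  has a center on it before and after the flip. If the second center is \<open>x\<close>, then
  \<open>d\<close> has a rotation; otherwise the centers coincide, and two colorings that differ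
  only at \<open>x\<close> share a nontrivial rotation.\<close>

lemma no_axis_through_one_point:
  fixes d :: "'a::circle_group \<Rightarrow> bool"
  assumes ro: "reflections_only d X" and X: "X = {x, y, z}"
    and scalene: "\<not> symmetric (\<lambda>u. u \<in> X)" and dist: "distinct [x, y, z]"
    and k: "refl_inv d (x + x)" and colors: "d x = d z" "d y = d z"
    and nfix: "y + y \<noteq> x + x" "z + z \<noteq> x + x"
  shows False
proof -
  have yz: "y + z \<noteq> x + x" using symmetric_isosceles [of x y z] scalene X by auto
  have center: "\<exists>e. e + e = x + x \<and> d' e \<noteq> d' y \<and> rot_inv (toggle d' {e}) (e - y)"
    if ro': "reflections_only d' X" and k': "refl_inv d' (x + x)" and c: "d' y = d' z" for d'
  proof -
    obtain ly lz where l: "refl_inv (toggle d' {y}) ly" "ly \<noteq> y + y"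
      "refl_inv (toggle d' {z}) lz" "lz \<noteq> z + z"
      using reflections_only_point [OF ro' k'] X nfix by (metis insertCI)
    have "y \<noteq> z" using dist by simp
    from toggled_pair_center [OF k' l(1,3) this c yz l(2,4) refl] show ?thesis by blast
  qed
  define d' where "d' = toggle d {x}"
  have ro': "reflections_only d' X" using reflections_only_toggle [OF ro] X by (simp add: d'_def)
  have k': "refl_inv d' (x + x)" using k by (simp add: d'_def refl_inv_toggle_fixed)
  have "d' y = d' z" using colors dist by (auto simp: d'_def toggle_def)
  then obtain e' where e': "e' + e' = x + x" "rot_inv (toggle d' {e'}) (e' - y)"
    using center [OF ro' k'] by blast
  obtain e where e: "e + e = x + x" "d e \<noteq> d y" "rot_inv (toggle d {e}) (e - y)"
    using center [OF ro k colors(2)] by blast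
  have "e \<noteq> x" "e \<noteq> y" using e(2) colors by auto
  show False
  proof (cases "e' = x")
    case True
    then have "rot_inv (toggle d {}) (x - y)" using e'(2) by (simp add: d'_def toggle_toggle)
    then show False using ro dist unfolding reflections_only_def by fastforce
  next
    case False
    then have "e' = e" using involution_diff [of e' "x + x" e x] e e' \<open>e \<noteq> x\<close> by simp
    then have "toggle d' {e'} = toggle (toggle d {e}) {x}"
      by (auto simp: d'_def toggle_def fun_eq_iff)
    then have "toggle (toggle d {e}) {x} (x + (e - y)) = toggle (toggle d {e}) {x} x"
      using e'(2) \<open>e' = e\<close> unfolding rot_inv_def by simp
    moreover have "toggle d {e} (x + (e - y)) = toggle d {e} x"
      using e(3) unfolding rot_inv_def by simp
    moreover have "x + (e - y) \<noteq> x" using \<open>e \<noteq> y\<close> by simp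
    ultimately show False unfolding toggle_def [of _ "{x}"] by simp
  qed
qed

lemma axis_through_two_points:
  fixes d :: "'a::circle_group \<Rightarrow> bool"
  assumes ro: "reflections_only d X" and X: "X = {x, y, z}"
    and scalene: "\<not> symmetric (\<lambda>u. u \<in> X)" and dist: "distinct [x, y, z]"
    and k: "refl_inv d k" and colors: "d x = d z" "d y = d z"
  shows "(x + x = k \<and> y + y = k) \<or> (x + x = k \<and> z + z = k) \<or> (y + y = k \<and> z + z = k)"
proof (rule ccontr)
  assume neg: "\<not> ?thesis"
  have perm: "X = {y, z, x}" "X = {x, z, y}" "X = {y, x, z}" "X = {z, x, y}"
    "X = {z, y, x}" using X by auto
  have one: False if "X = {a, b, c}" "distinct [a, b, c]" "a + a = k" "d a = d c" "d b = d c"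
    "b + b \<noteq> k" "c + c \<noteq> k" for a b c
    using no_axis_through_one_point [OF ro that(1) scalene that(2) _ that(4,5)] k that by auto
  have none: False if "X = {a, b, c}" "distinct [a, b, c]" "d a = d c" "d b = d c"
    "a + a \<noteq> k" "b + b \<noteq> k" "c + c \<noteq> k" "a + c \<noteq> k" "b + c \<noteq> k" for a b c
    using no_axis_through_triple [OF ro that(1) scalene that(2) k that(3-)] .
  have nf: "x + x \<noteq> k" "y + y \<noteq> k" "z + z \<noteq> k"
    using one [of x y z] one [of y x z] one [of z x y] X perm dist colors neg by auto
  \<comment> \<open>The axis swaps at most one pair of points; the labels are permuted so that the
    last point is outside such a pair.\<close>
  have "x + y = x + z \<longleftrightarrow> False" "x + y = y + z \<longleftrightarrow> False" "x + z = y + z \<longleftrightarrow> False"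
    using dist by (auto simp: add.commute)
  then consider "x + z \<noteq> k" "y + z \<noteq> k" | "x + y \<noteq> k" "z + y \<noteq> k" | "y + x \<noteq> k" "z + x \<noteq> k"
    by (metis add.commute)
  then show False
  proof cases
    case 1
    show False by (rule none [OF X _ _ _ nf 1]) (use dist colors in auto)
  next
    case 2
    show False by (rule none [OF perm(2) _ _ _ nf(1,3,2) 2]) (use dist colors in auto)
  next
    case 3
    show False by (rule none [OF perm(1) _ _ _ nf(2,3,1) 3]) (use dist colors in auto)
  qed
qed

theorem exists_asymmetric_toggle:
  fixes c :: "'a::circle_group \<Rightarrow> bool"
  assumes X: "X = {x, y, z}" and scalene: "\<not> symmetric (\<lambda>u. u \<in> X)"
  shows "\<exists>A\<subseteq>X. \<not> symmetric (toggle c A)"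
proof (rule ccontr)
  assume "\<not> ?thesis"
  then have sym: "symmetric (toggle c A)" if "A \<subseteq> X" for A using that by blast
  have pair: "symmetric (\<lambda>u. u \<in> {v, w})" for v w :: 'a
  proof -
    have "v + w - u = v \<longleftrightarrow> u = w" "v + w - u = w \<longleftrightarrow> u = v" for u by (auto simp: algebra_simps)
    then have "refl_inv (\<lambda>u. u \<in> {v, w}) (v + w)" by (auto simp: refl_inv_def)
    then show ?thesis unfolding symmetric_iff by blast
  qed
  have dist: "distinct [x, y, z]"
  proof (rule ccontr)
    assume "\<not> ?thesis"
    then have "X = {y, z} \<or> X = {x, z}" using X by auto
    then show False using pair scalene by blast
  qed
  have ro: "reflections_only c X"
  proof -
    have rot: "t = 0" if A: "A \<subseteq> X" and t: "rot_inv (toggle c A) t" for A t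
    proof (rule ccontr)
      assume "t \<noteq> 0"
      have "symmetric (toggle (toggle c A) B)" if "B \<subseteq> {x, y, z}" for B
      proof -
        have "(A - B) \<union> (B - A) \<subseteq> X" using A that X by blast
        then show ?thesis unfolding toggle_toggle by (rule sym)
      qed
      then have "symmetric (\<lambda>u. u \<in> {x, y, z})"
        using symmetric_triple_if_rotation [OF t \<open>t \<noteq> 0\<close> _ dist] by blast
      then show False using scalene X by simp
    qed
    show ?thesis
      unfolding reflections_only_def using sym [unfolded symmetric_iff] rot by metis
  qed
  \<comment> \<open>\<open>d\<close> is False and \<open>d'\<close> is True on all of
    \<open>X\<close>.\<close>
  define d where "d = toggle c {w \<in> X. c w}"
  define d' where "d' = toggle d X"
  have ro: "reflections_only d X" using reflections_only_toggle [OF ro] by (simp add: d_def)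
  then have ro': "reflections_only d' X" unfolding d'_def by (rule reflections_only_toggle) simp
  have colors: "d x = d z" "d y = d z" "d' x = d' z" "d' y = d' z"
    by (auto simp: d_def d'_def toggle_def X)
  obtain k where k: "refl_inv d k"
    using ro unfolding reflections_only_def by (metis empty_subsetI toggle_empty)
  obtain l where l: "refl_inv d' l"
    using ro' unfolding reflections_only_def by (metis empty_subsetI toggle_empty)
  \<comment> \<open>Each axis fixes two of three points, so the axes have a fixed point in common,
    whose double is both \<open>k\<close> and \<open>l\<close>. The common reflection preserves the
    set where \<open>d\<close> and \<open>d'\<close> differ, namely \<open>X\<close>.\<close>
  have "k = l"
    using axis_through_two_points [OF ro X scalene dist k colors(1,2)]
      axis_through_two_points [OF ro' X scalene dist l colors(3,4)] by auto
  then have "(k - u \<in> X) = (u \<in> X)" for u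
    using k l unfolding refl_inv_def d'_def toggle_def by metis
  then show False using scalene unfolding symmetric_iff refl_inv_def by blast
qed

section \<open>Isosceles triples on the circle\<close>

text \<open>A nontrivial rotation permutes the triple cyclically, with equal steps. A reflection
  fixes one of the three points but not all, so it exchanges the other two.\<close>

lemma symmetric_triple_imp_isosceles:
  fixes x :: "'a::circle_group"
  assumes "symmetric (\<lambda>u. u \<in> {x, y, z})" "distinct [x, y, z]"
  shows "x + x = y + z \<or> y + y = x + z \<or> z + z = x + y"
  using assms(1) unfolding symmetric_iff
proof (elim disjE exE conjE)
  fix t assume t: "t \<noteq> 0" "rot_inv (\<lambda>u. u \<in> {x, y, z}) t"
  have mem: "x + t \<in> {x, y, z}" "y + t \<in> {x, y, z}" "z + t \<in> {x, y, z}"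
    using t(2) unfolding rot_inv_def by blast+
  have inj: "x + t \<noteq> y + t" "x + t \<noteq> z + t" "y + t \<noteq> z + t" using assms(2) by auto
  consider "x + t = y" "y + t = z" | "x + t = z" "z + t = y"
    using mem inj t(1) by (auto simp del: add_right_cancel)
  then show ?thesis by cases (auto simp: algebra_simps)
next
  fix k assume k: "refl_inv (\<lambda>u. u \<in> {x, y, z}) k"
  have "k - x \<in> {x, y, z}" "k - y \<in> {x, y, z}" "k - z \<in> {x, y, z}"
    using k unfolding refl_inv_def by blast+
  moreover have "\<not> (x + x = k \<and> y + y = k \<and> z + z = k)"
    using involution_diff [of x k y z] assms(2) by auto
  ultimately show ?thesis using assms(2) by (auto simp: algebra_simps)
qed

\<comment> \<open>The circle group as a quotient of the reals\<close>
quotient_type circle = real / "\<lambda>x y. x - y \<in> \<int>"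
proof (rule equivpI)
  show "symp (\<lambda>x y::real. x - y \<in> \<int>)"
    by (rule sympI) (metis Ints_minus minus_diff_eq)
  show "transp (\<lambda>x y::real. x - y \<in> \<int>)"
    by (rule transpI) (metis Ints_add diff_add_cancel add_diff_eq)
qed (simp add: reflp_def)

instantiation circle :: ab_group_add
begin

lift_definition zero_circle :: circle is 0 .

lift_definition plus_circle :: "circle \<Rightarrow> circle \<Rightarrow> circle" is "(+)"
  by (metis Ints_add add_diff_add)

lift_definition uminus_circle :: "circle \<Rightarrow> circle" is uminus
  by (metis Ints_minus minus_diff_minus)

lift_definition minus_circle :: "circle \<Rightarrow> circle \<Rightarrow> circle" is "(-)"
  by (metis Ints_diff diff_diff_eq diff_add_eq diff_diff_eq2 add_diff_eq add.commute)

instance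
  by standard (transfer; simp)+

end

lemma abs_circle_eq_iff: "abs_circle x = abs_circle y \<longleftrightarrow> x - y \<in> \<int>"
  by (rule circle.abs_eq_iff)

instance circle :: circle_group
proof
  fix s t :: circle
  assume "s + s = 0" "t + t = 0" "s \<noteq> 0" "t \<noteq> 0"
  then show "s = t"
  proof transfer
    fix s t :: real
    assume "s + s - 0 \<in> \<int>" "t + t - 0 \<in> \<int>" "s - 0 \<notin> \<int>" "t - 0 \<notin> \<int>"
    moreover have "\<exists>j. u = of_int j + 1 / 2" if u: "u + u \<in> \<int>" "u \<notin> \<int>" for u :: real
    proof -
      obtain n where n: "u + u = of_int n" using u(1) by (rule Ints_cases)
      have "odd n"
      proof
        assume "even n"
        then obtain j where "n = 2 * j" by blast
        then have "u = of_int j" using n by simp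
        then show False using u(2) by simp
      qed
      then obtain j where "n = 2 * j + 1" by (rule oddE)
      then have "u = of_int j + 1 / 2" using n by simp
      then show ?thesis by blast
    qed
    ultimately obtain i j where "s = of_int i + 1 / 2" "t = of_int j + 1 / 2"
      by (metis diff_zero)
    then have "s - t = of_int (i - j)" by simp
    then show "s - t \<in> \<int>" by (metis Ints_of_int)
  qed
qed

lift_definition representative :: "circle \<Rightarrow> real" is frac
proof -
  fix x y :: real
  assume "x - y \<in> \<int>"
  then obtain n where "x - y = of_int n" by (rule Ints_cases)
  then have "x = y + of_int n" by simp
  then show "frac x = frac y" by (simp add: frac_def)
qed

lemma abs_circle_frac [simp]: "abs_circle (frac x) = abs_circle x"
proof -
  have "frac x - x = of_int (- \<lfloor>x\<rfloor>)" by (simp add: frac_def)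
  then show ?thesis by (metis abs_circle_eq_iff Ints_of_int)
qed

lemma representative_abs_circle: "x \<in> S1 \<Longrightarrow> representative (abs_circle x) = x"
  by (simp add: representative.abs_eq S1_def frac_eq)

lemma abs_circle_representative: "abs_circle (representative u) = u"
  by (induction u) (simp add: representative.abs_eq)

lemma representative_in_S1: "representative u \<in> S1"
  by (induction u) (simp add: representative.abs_eq S1_def frac_lt_1)

section \<open>Transfer between the circle group and \<open>S1\<close>\<close>

lemma abs_circle_act:
  "abs_circle (act (Rot a) x) = abs_circle x + abs_circle a"
  "abs_circle (act (Refl a) x) = abs_circle (2 * a) - abs_circle x"
  by (simp_all add: plus_circle.abs_eq minus_circle.abs_eq)

lemma distinguishing_of_asymmetric:
  assumes "\<not> symmetric D"
  shows "distinguishing (\<lambda>x. D (abs_circle x))"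
  unfolding distinguishing_def
proof (intro allI impI)
  fix g
  assume "\<forall>x\<in>S1. D (abs_circle (act g x)) = D (abs_circle x)"
  then have inv: "D (abs_circle (act g (representative u))) = D u" for u
    by (metis representative_in_S1 abs_circle_representative)
  show "is_identity g"
  proof (cases g)
    case (Rot a)
    then have "rot_inv D (abs_circle a)"
      using inv by (simp add: rot_inv_def abs_circle_act abs_circle_representative del: act.simps)
    then have "abs_circle a = 0" using assms unfolding symmetric_iff by blast
    then have "abs_circle (act g x) = abs_circle x" for x
      using Rot by (simp add: abs_circle_act del: act.simps)
    moreover have "act g x \<in> S1" for x using Rot by (simp add: S1_def frac_lt_1)
    ultimately show ?thesis
      unfolding is_identity_def by (metis representative_abs_circle)
  next
    case (Refl a)
    then have "refl_inv D (abs_circle (2 * a))"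
      using inv by (simp add: refl_inv_def abs_circle_act abs_circle_representative del: act.simps)
    then show ?thesis using assms unfolding symmetric_iff by blast
  qed
qed

text \<open>Only the triple is recolored; the rest of \<open>W\<close> keeps the values of the total
  function \<open>c\<close>.\<close>

lemma P_if_scalene_triple:
  assumes W: "W \<subseteq> S1" "{x, y, z} \<subseteq> W"
    and scalene: "\<not> symmetric (\<lambda>u. u \<in> {abs_circle x, abs_circle y, abs_circle z})"
  shows "P W"
  unfolding P_def
proof
  fix c :: "real \<Rightarrow> bool"
  obtain A where A: "A \<subseteq> {abs_circle x, abs_circle y, abs_circle z}"
      "\<not> symmetric (toggle (\<lambda>u. c (representative u)) A)"
    using exists_asymmetric_toggle [OF refl scalene, of "\<lambda>u. c (representative u)"] by auto
  then have "A \<subseteq> abs_circle ` W" using W(2) by auto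
  then have "abs_circle v \<notin> A" if "v \<in> S1 - W" for v
    using that W(1) representative_abs_circle by (metis DiffE imageE subsetD)
  then show "\<exists>d. distinguishing d \<and> (\<forall>x\<in>S1 - W. d x = c x)"
    using distinguishing_of_asymmetric [OF A(2)]
    by (intro exI [of _ "\<lambda>x. toggle (\<lambda>u. c (representative u)) A (abs_circle x)"])
      (simp add: toggle_def representative_abs_circle)
qed

text \<open>Two of the arcs \<open>q - p\<close>, \<open>r - q\<close> and
  \<open>1 - (r - p)\<close> agree. The congruences modulo 1 become equations because, after a shift
  by an integer, each side difference lies strictly between -1 and 1.\<close>

lemma isosceles_arcs:
  assumes "symmetric (\<lambda>u. u \<in> {abs_circle p, abs_circle q, abs_circle r})"
    and "p < q" "q < r" "r < p + 1"
  shows "q - p = r - q \<or> 2 * (q - p) + (r - q) = 1 \<or> (q - p) + 2 * (r - q) = 1"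
proof -
  have small: "u = 0" if u: "u \<in> \<int>" "-1 < u" "u < 1" for u :: real
    using u by (elim Ints_cases) auto
  have "abs_circle p \<noteq> abs_circle q" "abs_circle p \<noteq> abs_circle r" "abs_circle q \<noteq> abs_circle r"
    using small [of "p - q"] small [of "p - r"] small [of "q - r"] assms(2-)
    by (auto simp: abs_circle_eq_iff)
  then have "abs_circle p + abs_circle p = abs_circle q + abs_circle r \<or>
    abs_circle q + abs_circle q = abs_circle p + abs_circle r \<or>
    abs_circle r + abs_circle r = abs_circle p + abs_circle q"
    using symmetric_triple_imp_isosceles [OF assms(1)] by simp
  then consider "p + p - (q + r) \<in> \<int>" | "q + q - (p + r) \<in> \<int>" | "r + r - (p + q) \<in> \<int>"
    by (auto simp: plus_circle.abs_eq abs_circle_eq_iff)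
  then show ?thesis
  proof cases
    case 1
    then have "p + p - (q + r) + 1 \<in> \<int>" by simp
    then show ?thesis using small [of "p + p - (q + r) + 1"] assms(2-) by auto
  next
    case 2
    then show ?thesis using small [of "q + q - (p + r)"] assms(2-) by auto
  next
    case 3
    then have "r + r - (p + q) - 1 \<in> \<int>" by simp
    then show ?thesis using small [of "r + r - (p + q) - 1"] assms(2-) by auto
  qed
qed

text \<open>\<open>a\<close>, \<open>b\<close>, \<open>c\<close> are consecutive arcs. Four vertices
  of a regular pentagon leave one arc of 2/5 among arcs of 1/5, so \<open>a\<close> or
  \<open>b\<close> is 1/5.\<close>

lemma all_triples_isosceles:
  fixes a b c :: real
  assumes "0 < a" "0 < b" "0 < c" "a + b + c < 1"
    and "a = b \<or> 2 * a + b = 1 \<or> a + 2 * b = 1"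
    and "b = c \<or> 2 * b + c = 1 \<or> b + 2 * c = 1"
    and "a = b + c \<or> 2 * a + (b + c) = 1 \<or> a + 2 * (b + c) = 1"
    and "a + b = c \<or> 2 * (a + b) + c = 1 \<or> (a + b) + 2 * c = 1"
  shows "a = 1 / 5 \<or> b = 1 / 5 \<or> (a = 1 / 4 \<and> b = 1 / 4 \<and> c = 1 / 4)"
  using assms(5-8) assms(1-4) by (elim disjE) auto

lemma card_4_sorted:
  fixes W :: "real set"
  assumes "card W = 4"
  obtains p q r s where "W = {p, q, r, s}" "p < q" "q < r" "r < s"
proof -
  define l where "l = sorted_list_of_set W"
  have fin: "finite W" using assms by (metis card.infinite zero_neq_numeral)
  have len: "length l = 4" using assms fin by (simp add: l_def)
  then obtain p q r s where l: "l = [p, q, r, s]"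
    by (auto simp: numeral_eq_Suc length_Suc_conv)
  have "set l = W" "sorted l" "distinct l" using fin by (simp_all add: l_def)
  then have "W = {p, q, r, s}" "p < q" "q < r" "r < s" using l by auto
  then show ?thesis by (rule that)
qed

theorem theorem2p4p1:
  fixes W :: "real set"
  assumes "W \<subseteq> S1"
    and "card W = 4"
    and "trivial_pointwise_stabilizer W"
    and "T2 W"
  shows "P W \<or> congruent_sets W {0, 1/4, 1/2, 3/4}"
proof (cases "P W")
  case False
  obtain p q r s where W: "W = {p, q, r, s}" and less: "p < q" "q < r" "r < s"
    using card_4_sorted [OF assms(2)] .
  have range: "0 \<le> p" "s < 1" using assms(1) W by (auto simp: S1_def)
  have sym: "symmetric (\<lambda>u. u \<in> {abs_circle x, abs_circle y, abs_circle z})"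
    if "{x, y, z} \<subseteq> W" for x y z
    using P_if_scalene_triple [OF assms(1) that] False by blast
  have no_fifth: "w - v \<noteq> 1 / 5" if "v \<in> W" "w \<in> W" for v w
  proof
    assume "w - v = 1 / 5"
    then have "frac (v + real 1 / 5) = w"
      using that assms(1) by (auto simp: S1_def frac_eq)
    then have "w \<in> (\<lambda>x. frac (x + real 1 / 5)) ` W \<inter> W" using that by blast
    then show False using assms(4) unfolding T2_def by fastforce
  qed
  have "q - p = 1 / 4 \<and> r - q = 1 / 4 \<and> s - r = 1 / 4"
    using all_triples_isosceles [of "q - p" "r - q" "s - r"]
      isosceles_arcs [OF sym, of p q r] isosceles_arcs [OF sym, of q r s]
      isosceles_arcs [OF sym, of p q s] isosceles_arcs [OF sym, of p r s]
      no_fifth [of p q] no_fifth [of q r] less range W by auto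
  then have "act (Rot (- p)) ` W = {0, 1 / 4, 1 / 2, 3 / 4}"
    using W by (auto simp: frac_eq)
  then show ?thesis unfolding congruent_sets_def by metis
qed simp

end
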